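(* Let $(T,X)$ and $(T,Y)$ be two minimal semiflows on nonempty compact Hausdorff spaces with the same phase semigroup $T$. If $\pi\colon(T,X)\to(T,Y)$ is an epimorphism of almost 1-1 type and $(T,Y)$ is equicontinuous and surjective, then $(T,X)$ is an a.a. semiflow such that $\{x\in X : \pi^{-1}[\pi(x)]=\{x\}\}\subseteq P_{aa}(T,X)$.
   Context: $T$ is a topological semigroup with identity $e$. A semiflow $(T,X)$ is a jointly continuous map $T\times X\to X$, $(t,x)\mapsto tx$, with $ex=x$ and $t(sx)=(ts)x$. It is minimal if every orbit $Tx$ is dense in $X$, and surjective if $tX=X$ for all $t\in T$. An epimorphism $\pi\colon(T,X)\to(T,Y)$ is a continuous surjection with $\pi(tx)=t\pi(x)$ for all $t,x$; an epimorphism of minimal semiflows is of almost 1-1 type if there is $y\in Y$ with $\pi^{-1}[y]$ a singleton. $(T,Y)$ is equicontinuous if for every $y\in Y$ and every entourage $\varepsilon$ of the uniformity of $Y$ there is an entourage $\delta$ such that $(y,y')\in\delta$ implies $(ty,ty')\in\varepsilon$ for all $t\in T$. $x\in P_{aa}(T,X)$ (almost automorphic point) if for every net $\{t_n\}$ in $T$ and net $\{x_n'\}$ in $X$: $t_nx\to y$, $x_n'\to x'$ and $t_nx_n'=y$ for all $n$ imply $x=x'$. $(T,X)$ is an a.a. semiflow if there is $x\in P_{aa}(T,X)$ with dense orbit. *)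

theory Defs
  imports "HOL-Analysis.Analysis"
begin

text \<open>
  The phase semigroup is a type of class \<^class>\<open>topological_monoid_mult\<close> (a topological semigroup
  with identity \<open>1\<close>); phase spaces are types, hence nonempty.
\<close>

definition semiflow :: "('t::topological_monoid_mult \<Rightarrow> 'x::topological_space \<Rightarrow> 'x) \<Rightarrow> bool" where
  "semiflow f \<longleftrightarrow>
     continuous_on UNIV (\<lambda>(t, x). f t x) \<and>
     (\<forall>x. f 1 x = x) \<and>
     (\<forall>t s x. f t (f s x) = f (t * s) x)"

definition orbit :: "('t \<Rightarrow> 'x \<Rightarrow> 'x) \<Rightarrow> 'x \<Rightarrow> 'x set" where
  "orbit f x = range (\<lambda>t. f t x)"

definition minimal_semiflow ::
    "('t::topological_monoid_mult \<Rightarrow> 'x::topological_space \<Rightarrow> 'x) \<Rightarrow> bool" where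
  "minimal_semiflow f \<longleftrightarrow> semiflow f \<and> (\<forall>x. closure (orbit f x) = UNIV)"

definition surjective_semiflow :: "('t \<Rightarrow> 'x \<Rightarrow> 'x) \<Rightarrow> bool" where
  "surjective_semiflow f \<longleftrightarrow> (\<forall>t. surj (f t))"

definition epimorphism ::
    "('t \<Rightarrow> 'x::topological_space \<Rightarrow> 'x) \<Rightarrow> ('t \<Rightarrow> 'y::topological_space \<Rightarrow> 'y) \<Rightarrow> ('x \<Rightarrow> 'y) \<Rightarrow> bool" where
  "epimorphism f g \<pi> \<longleftrightarrow>
     continuous_on UNIV \<pi> \<and> surj \<pi> \<and> (\<forall>t x. \<pi> (f t x) = g t (\<pi> x))"

definition almost_one_one_epimorphism ::
    "('t \<Rightarrow> 'x::topological_space \<Rightarrow> 'x) \<Rightarrow> ('t \<Rightarrow> 'y::topological_space \<Rightarrow> 'y) \<Rightarrow> ('x \<Rightarrow> 'y) \<Rightarrow> bool" where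
  "almost_one_one_epimorphism f g \<pi> \<longleftrightarrow>
     epimorphism f g \<pi> \<and> (\<exists>y x. \<pi> -` {y} = {x})"

text \<open>
  An entourage is a set belonging to the filter \<^const>\<open>uniformity\<close>. A compact Hausdorff space
  carries exactly one uniformity inducing its topology, so for such a space the class
  \<^class>\<open>uniform_space\<close> adds no data to the topology.
\<close>

definition entourage :: "('y::uniform_space \<times> 'y) set \<Rightarrow> bool" where
  "entourage E \<longleftrightarrow> eventually (\<lambda>p. p \<in> E) uniformity"

definition equicontinuous :: "('t \<Rightarrow> 'y::uniform_space \<Rightarrow> 'y) \<Rightarrow> bool" where
  "equicontinuous g \<longleftrightarrow>
     (\<forall>y E. entourage E \<longrightarrow>
        (\<exists>D. entourage D \<and> (\<forall>y'. (y, y') \<in> D \<longrightarrow> (\<forall>t. (g t y, g t y') \<in> E))))"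

definition directed_by :: "'i set \<Rightarrow> ('i \<Rightarrow> 'i \<Rightarrow> bool) \<Rightarrow> bool" where
  "directed_by I le \<longleftrightarrow>
     I \<noteq> {} \<and>
     (\<forall>i\<in>I. le i i) \<and>
     (\<forall>i\<in>I. \<forall>j\<in>I. \<forall>k\<in>I. le i j \<longrightarrow> le j k \<longrightarrow> le i k) \<and>
     (\<forall>i\<in>I. \<forall>j\<in>I. \<exists>k\<in>I. le i k \<and> le j k)"

definition net_converges ::
    "'i set \<Rightarrow> ('i \<Rightarrow> 'i \<Rightarrow> bool) \<Rightarrow> ('i \<Rightarrow> 'x::topological_space) \<Rightarrow> 'x \<Rightarrow> bool" where
  "net_converges I le s l \<longleftrightarrow>
     (\<forall>U. open U \<longrightarrow> l \<in> U \<longrightarrow> (\<exists>i\<in>I. \<forall>j\<in>I. le i j \<longrightarrow> s j \<in> U))"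

text \<open>
  A definition cannot quantify over all index types, so the directed index sets range over the subsets
  of one fixed type, \<open>('t \<times> 'x) set \<times> ('t \<times> 'x)\<close>. This type is large enough to index all nets that
  matter: see \<open>P_aa_arbitrary_net\<close> below, where the type of indices is arbitrary.
\<close>

definition P_aa :: "('t \<Rightarrow> 'x::topological_space \<Rightarrow> 'x) \<Rightarrow> 'x set" where
  "P_aa f = {x. \<forall>(I :: (('t \<times> 'x) set \<times> ('t \<times> 'x)) set) le (t :: _ \<Rightarrow> 't) (x'' :: _ \<Rightarrow> 'x) y x'.
     directed_by I le \<longrightarrow>
     net_converges I le (\<lambda>n. f (t n) x) y \<longrightarrow>
     net_converges I le x'' x' \<longrightarrow>
     (\<forall>n\<in>I. f (t n) (x'' n) = y) \<longrightarrow>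
     x = x'}"

lemma P_aa_arbitrary_net:
  fixes f :: "'t \<Rightarrow> 'x::topological_space \<Rightarrow> 'x" and J :: "'j set"
  assumes x: "x \<in> P_aa f"
    and dir: "directed_by J le"
    and conv1: "net_converges J le (\<lambda>n. f (t n) x) y"
    and conv2: "net_converges J le x'' x'"
    and eq: "\<forall>n\<in>J. f (t n) (x'' n) = y"
  shows "x = x'"
proof -
  define s where "s = (\<lambda>j. (t j, x'' j))"
  define tail where "tail = (\<lambda>i. s ` {j\<in>J. le i j})"
  define I where "I = {(A, p). (\<exists>i\<in>J. A = tail i) \<and> p \<in> A}"
  define ge :: "('t \<times> 'x) set \<times> ('t \<times> 'x) \<Rightarrow> _"
    where "ge = (\<lambda>a (b :: ('t \<times> 'x) set \<times> ('t \<times> 'x)). fst b \<subseteq> fst a)"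
  have tail_ne: "s i \<in> tail i" if "i \<in> J" for i
    using that dir unfolding tail_def directed_by_def by auto
  have tail_mono: "tail k \<subseteq> tail i" if "i \<in> J" "k \<in> J" "le i k" for i k
  proof
    fix q assume "q \<in> tail k"
    then obtain j where "j \<in> J" "le k j" "q = s j"
      unfolding tail_def by auto
    moreover have "le i j"
      using dir that \<open>j \<in> J\<close> \<open>le k j\<close> unfolding directed_by_def by blast
    ultimately show "q \<in> tail i"
      unfolding tail_def by auto
  qed
  have "directed_by I ge"
    unfolding directed_by_def
  proof (intro conjI ballI impI)
    obtain i where "i \<in> J"
      using dir unfolding directed_by_def by auto
    then have "(tail i, s i) \<in> I"
      using tail_ne unfolding I_def by auto
    then show "I \<noteq> {}" by auto
  next
    fix a b assume "a \<in> I" "b \<in> I"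
    then obtain i j where ij: "i \<in> J" "j \<in> J" "fst a = tail i" "fst b = tail j"
      unfolding I_def by auto
    obtain k where k: "k \<in> J" "le i k" "le j k"
      using dir ij unfolding directed_by_def by meson
    have "(tail k, s k) \<in> I"
      using k tail_ne unfolding I_def by auto
    moreover have "ge a (tail k, s k)" "ge b (tail k, s k)"
      using tail_mono ij k unfolding ge_def by auto
    ultimately show "\<exists>c\<in>I. ge a c \<and> ge b c" by blast
  qed (auto simp: ge_def)
  moreover have conv: "net_converges I ge (\<lambda>n. h (snd n)) l"
    if h: "net_converges J le (\<lambda>j. h (s j)) l" for h :: "'t \<times> 'x \<Rightarrow> 'x" and l
    unfolding net_converges_def
  proof (intro allI impI)
    fix U assume "open U" "l \<in> U"
    then obtain i where i: "i \<in> J" "\<forall>j\<in>J. le i j \<longrightarrow> h (s j) \<in> U"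
      using h unfolding net_converges_def by meson
    have "h (snd n) \<in> U" if "n \<in> I" "ge (tail i, s i) n" for n
    proof -
      have "snd n \<in> tail i"
        using that unfolding I_def ge_def by auto
      then show ?thesis
        using i unfolding tail_def by auto
    qed
    moreover have "(tail i, s i) \<in> I"
      using i tail_ne unfolding I_def by auto
    ultimately show "\<exists>i\<in>I. \<forall>j\<in>I. ge i j \<longrightarrow> h (snd j) \<in> U" by blast
  qed
  have "net_converges I ge (\<lambda>n. f (fst (snd n)) x) y"
    using conv[of "\<lambda>p. f (fst p) x" y] conv1 by (simp add: s_def)
  moreover have "net_converges I ge (\<lambda>n. snd (snd n)) x'"
    using conv[of snd x'] conv2 by (simp add: s_def)
  moreover have "\<forall>n\<in>I. f (fst (snd n)) (snd (snd n)) = y"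
    using eq unfolding I_def tail_def s_def by auto
  ultimately show ?thesis
    using x[unfolded P_aa_def mem_Collect_eq,
      THEN spec[of _ I], THEN spec[of _ ge], THEN spec[of _ "\<lambda>n. fst (snd n)"],
      THEN spec[of _ "\<lambda>n. snd (snd n)"], THEN spec[of _ y], THEN spec[of _ x']]
    by simp
qed

definition aa_semiflow ::
    "('t::topological_monoid_mult \<Rightarrow> 'x::topological_space \<Rightarrow> 'x) \<Rightarrow> bool" where
  "aa_semiflow f \<longleftrightarrow> semiflow f \<and> (\<exists>x\<in>P_aa f. closure (orbit f x) = UNIV)"

end

theory Submission
  imports Defs
begin

text \<open>
  Applying \<open>\<pi>\<close> to the nets in the definition of an almost automorphic point reduces the theorem to
  distality of \<open>Y\<close>: equicontinuity at \<open>\<pi> x'\<close> turns \<open>t\<^sub>n (\<pi> x''\<^sub>n) = \<pi> y\<close> into \<open>t\<^sub>n (\<pi> x') \<rightarrow> \<pi> y\<close>, so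
  \<open>\<pi> x\<close> and \<open>\<pi> x'\<close> are proximal. For distality, the powers of a fixed \<open>t\<close> form a totally bounded
  family in the uniform metric, so two of them, \<open>t\<^sup>m\<close> and \<open>t\<^sup>n\<close> with \<open>m < n\<close>, are uniformly close;
  since \<open>t\<^sup>m\<close> is surjective, \<open>t\<^sup>n\<^sup>-\<^sup>m\<close> is uniformly close to the identity. If \<open>t a\<close> and \<open>t b\<close> are both close
  to \<open>z\<close>, then \<open>t\<^sup>n\<^sup>-\<^sup>m a\<close> and \<open>t\<^sup>n\<^sup>-\<^sup>m b\<close> are both close to \<open>t\<^sup>n\<^sup>-\<^sup>m\<^sup>-\<^sup>1 z\<close> by equicontinuity at \<open>z\<close>, hence
  \<open>a\<close> and \<open>b\<close> are close.
\<close>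

text \<open>Four factors suit the four-link chains of the two main estimates; reflexivity pads
  shorter chains.\<close>

lemma entourage_quarter:
  fixes E :: "('y::uniform_space \<times> 'y) set"
  assumes "entourage E"
  obtains D where "entourage D" "refl D" "sym D" "D O D O D O D \<subseteq> E"
proof -
  have half: "\<exists>D. entourage D \<and> (\<forall>x y z. (x, y) \<in> D \<longrightarrow> (y, z) \<in> D \<longrightarrow> (x, z) \<in> F)"
    if F: "entourage F" for F :: "('y \<times> 'y) set"
  proof -
    obtain D where "eventually D uniformity" "\<And>x y z. D (x, y) \<Longrightarrow> D (y, z) \<Longrightarrow> (x, z) \<in> F"
      using uniformity_transE[OF F[unfolded entourage_def]] by metis
    then show ?thesis
      by (intro exI[of _ "Collect D"]) (auto simp: entourage_def)
  qed
  obtain F where F: "entourage F" "\<And>x y z. (x, y) \<in> F \<Longrightarrow> (y, z) \<in> F \<Longrightarrow> (x, z) \<in> E"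
    using half[OF assms] by blast
  obtain G where G: "entourage G" "\<And>x y z. (x, y) \<in> G \<Longrightarrow> (y, z) \<in> G \<Longrightarrow> (x, z) \<in> F"
    using half[OF F(1)] by blast
  define D where "D = {p. p \<in> G \<and> prod.swap p \<in> G}"
  show ?thesis
  proof
    have "eventually (\<lambda>(x, y). (y, x) \<in> G) uniformity"
      using uniformity_sym G(1) unfolding entourage_def by blast
    with G(1) show "entourage D"
      unfolding entourage_def D_def by eventually_elim auto
    show "refl D"
      using uniformity_refl[of "\<lambda>p. p \<in> G"] G(1) by (auto simp: entourage_def D_def refl_on_def)
    show "sym D"
      by (auto simp: D_def sym_def)
    have "D \<subseteq> G"
      by (auto simp: D_def)
    then show "D O D O D O D \<subseteq> E"
      by (auto intro!: F(2) intro: G(2))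
  qed
qed

lemma entourage_neighbourhood:
  fixes p :: "'y::uniform_space"
  assumes "entourage E"
  obtains U where "open U" "p \<in> U" "\<And>y. y \<in> U \<Longrightarrow> (p, y) \<in> E"
proof -
  have "eventually (\<lambda>y. (p, y) \<in> E) (nhds p)"
    using assms unfolding eventually_nhds_uniformity entourage_def
    by (auto elim!: eventually_mono)
  then show ?thesis
    using that unfolding eventually_nhds by blast
qed

lemma eq_if_in_all_entourages:
  fixes a b :: "'y::{uniform_space,t2_space}"
  assumes "\<And>E. entourage E \<Longrightarrow> (a, b) \<in> E"
  shows "a = b"
proof (rule ccontr)
  assume "a \<noteq> b"
  then obtain U where "open U" "a \<in> U" "b \<notin> U"
    using t1_space by blast
  \<comment> \<open>This is the openness of \<open>U\<close> at \<open>a\<close>, read through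
    \<open>open_uniformity\<close>.\<close>
  then have "entourage {(x, y). x = a \<longrightarrow> y \<in> U}"
    unfolding open_uniformity entourage_def by (auto elim!: eventually_mono)
  then show False
    using assms \<open>b \<notin> U\<close> by blast
qed

lemma equicontinuous_surjective_power_near_id:
  fixes g :: "'t::topological_monoid_mult \<Rightarrow> 'y::uniform_space \<Rightarrow> 'y"
  assumes comp: "compact (UNIV :: 'y set)" and flow: "semiflow g"
    and equi: "equicontinuous g" and surj: "surjective_semiflow g" and E: "entourage E"
  obtains k where "\<And>y. (y, g (t ^ Suc k) y) \<in> E"
proof -
  obtain D where D: "entourage D" "refl D" "sym D" "D O D O D O D \<subseteq> E"
    by (rule entourage_quarter[OF E]) (rule that)
  have "\<exists>U. open U \<and> p \<in> U \<and> (\<forall>y\<in>U. \<forall>s. (g s p, g s y) \<in> D)" for p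
  proof -
    obtain D' where D': "entourage D'" "\<And>y s. (p, y) \<in> D' \<Longrightarrow> (g s p, g s y) \<in> D"
      using equi D(1) unfolding equicontinuous_def by meson
    obtain U where "open U" "p \<in> U" "\<And>y. y \<in> U \<Longrightarrow> (p, y) \<in> D'"
      using entourage_neighbourhood[OF D'(1), of p] by blast
    then show ?thesis
      using D'(2) by blast
  qed
  then obtain U where U: "\<And>p. open (U p)" "\<And>p. p \<in> U p"
      "\<And>p y s. y \<in> U p \<Longrightarrow> (g s p, g s y) \<in> D"
    by metis
  obtain P where P: "finite P" "UNIV \<subseteq> (\<Union>p\<in>P. U p)"
    using compactE_image[OF comp, of UNIV U] U(1,2) by (metis UNIV_I UN_I subsetI)
  then have "\<forall>y. \<exists>p\<in>P. y \<in> U p"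
    by blast
  then obtain c where c: "\<And>y. c y \<in> P" "\<And>y. y \<in> U (c y)"
    by metis
  \<comment> \<open>\<open>h m\<close> tabulates which cover set receives each centre under
    \<open>t ^ m\<close>. Restricting to \<open>P\<close> leaves finitely many tables, so two powers
    share one.\<close>
  define h where "h = (\<lambda>m. restrict (\<lambda>p. c (g (t ^ m) p)) P)"
  have "range h \<subseteq> P \<rightarrow>\<^sub>E P"
    using c(1) by (auto simp: h_def)
  then have "finite (range h)"
    by (rule finite_subset) (simp add: P(1) finite_PiE)
  then have "\<not> inj h"
    by (metis finite_imageD infinite_UNIV_nat)
  then obtain m n where mn: "m < n" "h m = h n"
    by (metis injI linorder_neqE_nat)
  define k where "k = n - m - 1"
  have n: "n = Suc k + m"
    using mn(1) by (simp add: k_def)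
  have "(y, g (t ^ Suc k) y) \<in> E" for y
  proof -
    \<comment> \<open>Surjectivity turns closeness of \<open>t ^ m\<close> and \<open>t ^ n\<close>
      at \<open>w\<close> into closeness of the identity and \<open>t ^ Suc k\<close> at
      \<open>y\<close>.\<close>
    obtain w where w: "y = g (t ^ m) w"
      using surj unfolding surjective_semiflow_def by (metis surjD)
    define p q where "p = c w" and "q = c (g (t ^ m) p)"
    have p: "p \<in> P" "w \<in> U p"
      using c by (auto simp: p_def)
    have "q = c (g (t ^ n) p)"
      using fun_cong[OF mn(2), of p] p(1) by (simp add: h_def q_def)
    then have "g (t ^ m) p \<in> U q" "g (t ^ n) p \<in> U q"
      using c(2) by (metis q_def)+
    then have "(q, g (t ^ m) p) \<in> D" "(q, g (t ^ n) p) \<in> D"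
      using U(3)[of _ q 1] flow by (auto simp: semiflow_def)
    moreover have "(g (t ^ m) p, g (t ^ m) w) \<in> D" "(g (t ^ n) p, g (t ^ n) w) \<in> D"
      using U(3)[OF p(2)] by auto
    \<comment> \<open>The chain runs from \<open>t ^ m\<close> at \<open>w\<close> to
      \<open>t ^ m\<close> at \<open>p\<close>, then \<open>q\<close>, then \<open>t ^ n\<close> at
      \<open>p\<close>, then \<open>t ^ n\<close> at \<open>w\<close>.\<close>
    ultimately have "(g (t ^ m) w, g (t ^ n) w) \<in> E"
      using D(3,4) by (meson relcompI subsetD symD)
    moreover have "g (t ^ n) w = g (t ^ Suc k) y"
      using flow unfolding n w power_add semiflow_def by metis
    ultimately show ?thesis
      by (simp add: w)
  qed
  then show ?thesis
    using that by blast
qed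

text \<open>\<open>prox\<close> is proximality without nets. The limit \<open>z\<close> is fixed in
  advance because equicontinuity is pointwise: \<open>D'\<close> must be chosen before
  \<open>t\<close>.\<close>

lemma equicontinuous_surjective_distal:
  fixes g :: "'t::topological_monoid_mult \<Rightarrow> 'y::{uniform_space,t2_space} \<Rightarrow> 'y"
  assumes comp: "compact (UNIV :: 'y set)" and flow: "semiflow g"
    and equi: "equicontinuous g" and surj: "surjective_semiflow g"
    and prox: "\<And>E. entourage E \<Longrightarrow> \<exists>t. (z, g t a) \<in> E \<and> (z, g t b) \<in> E"
  shows "a = b"
proof (rule eq_if_in_all_entourages)
  fix E :: "('y \<times> 'y) set"
  assume "entourage E"
  then obtain D where D: "entourage D" "refl D" "sym D" "D O D O D O D \<subseteq> E"
    by (rule entourage_quarter) (rule that)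
  obtain D' where D': "entourage D'" "\<And>y s. (z, y) \<in> D' \<Longrightarrow> (g s z, g s y) \<in> D"
    using equi D(1) unfolding equicontinuous_def by meson
  obtain t where t: "(z, g t a) \<in> D'" "(z, g t b) \<in> D'"
    using prox[OF D'(1)] by blast
  obtain k where k: "\<And>y. (y, g (t ^ Suc k) y) \<in> D"
    using equicontinuous_surjective_power_near_id[OF comp flow equi surj D(1)] by blast
  \<comment> \<open>The exponent is positive, so one \<open>t\<close> can act first and bring the
    point near \<open>z\<close>.\<close>
  have "g (t ^ Suc k) y = g (t ^ k) (g t y)" for y
    using flow unfolding power_Suc2 semiflow_def by metis
  then have "(g (t ^ k) z, g (t ^ Suc k) a) \<in> D" "(g (t ^ k) z, g (t ^ Suc k) b) \<in> D"
    using D'(2) t by metis+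
  then show "(a, b) \<in> E"
    using D(3,4) k by (meson relcompI subsetD symD)
qed

lemma net_converges_entourage:
  fixes l :: "'y::uniform_space"
  assumes "net_converges I le s l" "entourage E"
  obtains i where "i \<in> I" "\<And>j. j \<in> I \<Longrightarrow> le i j \<Longrightarrow> (l, s j) \<in> E"
proof -
  obtain U where "open U" "l \<in> U" "\<And>y. y \<in> U \<Longrightarrow> (l, y) \<in> E"
    using entourage_neighbourhood[OF assms(2), of l] by blast
  then show ?thesis
    using that assms(1) unfolding net_converges_def by meson
qed

lemma net_converges_continuous_image:
  assumes "net_converges I le s l" "continuous_on UNIV h"
  shows "net_converges I le (\<lambda>i. h (s i)) (h l)"
  unfolding net_converges_def
proof (intro allI impI)
  fix U assume "open U" "h l \<in> U"
  then have "open (h -` U)" "l \<in> h -` U"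
    using assms(2) by (auto intro: open_vimage)
  then show "\<exists>i\<in>I. \<forall>j\<in>I. le i j \<longrightarrow> h (s j) \<in> U"
    using assms(1) unfolding net_converges_def by (metis vimageD)
qed

text \<open>This makes every point of \<open>Y\<close> almost automorphic. The index type stays free
  because the nets to be used come from \<open>X\<close>.\<close>

lemma equicontinuous_surjective_net_unique:
  fixes g :: "'t::topological_monoid_mult \<Rightarrow> 'y::{uniform_space,t2_space} \<Rightarrow> 'y"
  assumes comp: "compact (UNIV :: 'y set)" and flow: "semiflow g"
    and equi: "equicontinuous g" and surj: "surjective_semiflow g"
    and dir: "directed_by I le"
    and a: "net_converges I le (\<lambda>n. g (t n) a) z"
    and b: "net_converges I le b' b"
    and eq: "\<And>n. n \<in> I \<Longrightarrow> g (t n) (b' n) = z"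
  shows "a = b"
proof (rule equicontinuous_surjective_distal[OF comp flow equi surj, of z])
  fix E :: "('y \<times> 'y) set"
  assume E: "entourage E"
  obtain D where D: "entourage D" "refl D" "sym D" "D O D O D O D \<subseteq> E"
    by (rule entourage_quarter[OF E]) (rule that)
  obtain D' where D': "entourage D'" "\<And>y s. (b, y) \<in> D' \<Longrightarrow> (g s b, g s y) \<in> D"
    using equi D(1) unfolding equicontinuous_def by meson
  obtain i where i: "i \<in> I" "\<And>n. n \<in> I \<Longrightarrow> le i n \<Longrightarrow> (z, g (t n) a) \<in> E"
    using net_converges_entourage[OF a E] by metis
  obtain j where j: "j \<in> I" "\<And>n. n \<in> I \<Longrightarrow> le j n \<Longrightarrow> (b, b' n) \<in> D'"
    using net_converges_entourage[OF b D'(1)] by metis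
  obtain n where n: "n \<in> I" "le i n" "le j n"
    using dir i(1) j(1) unfolding directed_by_def by meson
  \<comment> \<open>Equicontinuity is applied at the limit \<open>b\<close>, since the points
    \<open>b' n\<close> vary.\<close>
  have "(g (t n) b, z) \<in> D"
    using D'(2) j(2) n eq by metis
  then have "(z, g (t n) b) \<in> E"
    using D(2-4) by (meson relcompI subsetD reflD symD)
  then show "\<exists>t. (z, g t a) \<in> E \<and> (z, g t b) \<in> E"
    using i(2) n by blast
qed

theorem theorem3p6:
  fixes f :: "'t::topological_monoid_mult \<Rightarrow> 'x::t2_space \<Rightarrow> 'x"
    and g :: "'t \<Rightarrow> 'y::{uniform_space,t2_space} \<Rightarrow> 'y"
    and \<pi> :: "'x \<Rightarrow> 'y"
  assumes "compact (UNIV :: 'x set)"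
    and "compact (UNIV :: 'y set)"
    and "minimal_semiflow f"
    and "minimal_semiflow g"
    and "almost_one_one_epimorphism f g \<pi>"
    and "equicontinuous g"
    and "surjective_semiflow g"
  shows "aa_semiflow f \<and> {x. \<pi> -` {\<pi> x} = {x}} \<subseteq> P_aa f"
proof -
  have cont: "continuous_on UNIV \<pi>" and hom: "\<And>t x. \<pi> (f t x) = g t (\<pi> x)"
    using assms(5) unfolding almost_one_one_epimorphism_def epimorphism_def by auto
  have flow: "semiflow g"
    using assms(4) unfolding minimal_semiflow_def by blast
  have sub: "{x. \<pi> -` {\<pi> x} = {x}} \<subseteq> P_aa f"
  proof
    fix x assume "x \<in> {x. \<pi> -` {\<pi> x} = {x}}"
    then have fibre: "\<pi> -` {\<pi> x} = {x}"
      by simp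
    show "x \<in> P_aa f"
      unfolding P_aa_def mem_Collect_eq
    proof (intro allI impI)
      fix I :: "(('t \<times> 'x) set \<times> ('t \<times> 'x)) set" and le t x'' y x'
      assume dir: "directed_by I le"
        and conv: "net_converges I le (\<lambda>n. f (t n) x) y" "net_converges I le x'' x'"
        and eq: "\<forall>n\<in>I. f (t n) (x'' n) = y"
      have "\<pi> x = \<pi> x'"
      proof (rule equicontinuous_surjective_net_unique[OF assms(2) flow assms(6,7) dir])
        show "net_converges I le (\<lambda>n. g (t n) (\<pi> x)) (\<pi> y)"
          using net_converges_continuous_image[OF conv(1) cont] by (simp add: hom)
        show "net_converges I le (\<lambda>n. \<pi> (x'' n)) (\<pi> x')"
          using net_converges_continuous_image[OF conv(2) cont] .
        show "g (t n) (\<pi> (x'' n)) = \<pi> y" if "n \<in> I" for n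
          using eq that hom by metis
      qed
      then have "x' \<in> \<pi> -` {\<pi> x}"
        by simp
      then show "x = x'"
        unfolding fibre by simp
    qed
  qed
  \<comment> \<open>A singleton fibre supplies an almost automorphic point; minimality makes its
    orbit dense.\<close>
  obtain y x where "\<pi> -` {y} = {x}"
    using assms(5) unfolding almost_one_one_epimorphism_def by blast
  then have "\<pi> -` {\<pi> x} = {x}"
    by auto
  then have "x \<in> P_aa f"
    using sub by blast
  then show ?thesis
    using sub assms(3) unfolding aa_semiflow_def minimal_semiflow_def by blast
qed

end
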